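(* Let $S_n=P_{n-1}\vee K_1$ be the shell graph on $n\ge 3$ vertices, with apex $c$. Let $A\subseteq V(P_{n-1})$ and $S=\{c\}\cup A$. Then $S$ is a mutual-visibility set of $S_n$ if and only if $|A|\le 2$ and $d_{P_{n-1}}(u,v)\le 2$ for all $u,v\in A$.
   Context: Graphs are finite, simple, undirected and connected. For $X\subseteq V(G)$, two vertices $u,v\in V(G)$ are $X$-visible if there is a shortest $(u,v)$-path $P$ in $G$ with $V(P)\cap X\subseteq\{u,v\}$. A set $X\subseteq V(G)$ is a mutual-visibility set of $G$ if every pair of vertices of $X$ is $X$-visible (in particular the empty set and singletons are mutual-visibility sets). The shell graph $S_n=P_{n-1}\vee K_1$ is the join of a path $P_{n-1}$ on $n-1$ vertices with a single vertex $c$, called the apex. $d_{P_{n-1}}$ denotes graph distance within the path $P_{n-1}$. *)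

theory Defs
  imports "Graph_Theory.Graph_Theory"
begin

text \<open>
  Finite simple undirected graphs are instances of the locale \<open>pair_graph\<close>: finite, loop-free,
  and with a symmetric arc set, so that an undirected edge is a pair of opposite arcs.
  Walks and paths are arc lists; the length of the list is the number of edges.
\<close>

text \<open>Graph distance: the library's weighted distance with all arc weights equal to 1.\<close>

definition gdist :: "'a pair_pre_digraph \<Rightarrow> 'a \<Rightarrow> 'a \<Rightarrow> ereal" where
  "gdist G u v = wf_digraph.\<mu> (with_proj G) (\<lambda>_. 1) u v"

definition shortest_path :: "'a pair_pre_digraph \<Rightarrow> 'a \<Rightarrow> ('a \<times> 'a) awalk \<Rightarrow> 'a \<Rightarrow> bool" where
  "shortest_path G u p v \<longleftrightarrow>
     pre_digraph.apath (with_proj G) u p v \<and> ereal (real (length p)) = gdist G u v"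

definition visible :: "'a pair_pre_digraph \<Rightarrow> 'a set \<Rightarrow> 'a \<Rightarrow> 'a \<Rightarrow> bool" where
  "visible G X u v \<longleftrightarrow>
     (\<exists>p. shortest_path G u p v \<and>
          set (pre_digraph.awalk_verts (with_proj G) u p) \<inter> X \<subseteq> {u, v})"

definition mutual_visibility_set :: "'a pair_pre_digraph \<Rightarrow> 'a set \<Rightarrow> bool" where
  "mutual_visibility_set G X \<longleftrightarrow> X \<subseteq> pverts G \<and> (\<forall>u\<in>X. \<forall>v\<in>X. visible G X u v)"

definition path_graph :: "nat \<Rightarrow> nat pair_pre_digraph" where
  "path_graph k =
     \<lparr>pverts = {..<k}, parcs = {(i, j). i < k \<and> j < k \<and> (j = Suc i \<or> i = Suc j)}\<rparr>"

definition complete_graph :: "nat \<Rightarrow> nat pair_pre_digraph" where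
  "complete_graph k = \<lparr>pverts = {..<k}, parcs = {(i, j). i < k \<and> j < k \<and> i \<noteq> j}\<rparr>"

text \<open>The sum type makes the two vertex sets disjoint.\<close>

definition graph_join ::
    "'a pair_pre_digraph \<Rightarrow> 'b pair_pre_digraph \<Rightarrow> ('a + 'b) pair_pre_digraph" where
  "graph_join G H =
     \<lparr>pverts = Inl ` pverts G \<union> Inr ` pverts H,
      parcs = map_prod Inl Inl ` parcs G \<union> map_prod Inr Inr ` parcs H
            \<union> Inl ` pverts G \<times> Inr ` pverts H \<union> Inr ` pverts H \<times> Inl ` pverts G\<rparr>"

definition shell_graph :: "nat \<Rightarrow> (nat + nat) pair_pre_digraph" where
  "shell_graph n = graph_join (path_graph (n - 1)) (complete_graph 1)"

text \<open>The unique vertex of the summand \<open>complete_graph 1\<close>.\<close>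

definition apex :: "nat + nat" where
  "apex = Inr 0"

lemma pair_graph_path_graph: "pair_graph (path_graph k)"
proof -
  have "parcs (path_graph k) \<subseteq> {..<k} \<times> {..<k}"
    by (auto simp: path_graph_def)
  then have "finite (parcs (path_graph k))"
    by (rule finite_subset) simp
  then show ?thesis
    by unfold_locales (auto simp: path_graph_def arc_to_ends_def symmetric_def sym_def arcs_ends_def)
qed

lemma pair_graph_complete_graph: "pair_graph (complete_graph k)"
proof -
  have "parcs (complete_graph k) \<subseteq> {..<k} \<times> {..<k}"
    by (auto simp: complete_graph_def)
  then have "finite (parcs (complete_graph k))"
    by (rule finite_subset) simp
  then show ?thesis
    by unfold_locales
      (auto simp: complete_graph_def arc_to_ends_def symmetric_def sym_def arcs_ends_def)
qed

lemma pair_graph_graph_join: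
  assumes "pair_graph G" "pair_graph H"
  shows "pair_graph (graph_join G H)"
proof -
  interpret G: pair_graph G by fact
  interpret H: pair_graph H by fact
  have symG: "(y, x) \<in> parcs G" if "(x, y) \<in> parcs G" for x y
    using that G.arcs_symmetric by auto
  have symH: "(y, x) \<in> parcs H" if "(x, y) \<in> parcs H" for x y
    using that H.arcs_symmetric by auto
  show ?thesis
    unfolding graph_join_def
    by unfold_locales
      (auto simp: symmetric_def arcs_ends_def arc_to_ends_def intro!: symI
        dest: G.in_arcsD1 G.in_arcsD2 H.in_arcsD1 H.in_arcsD2 G.no_loops' H.no_loops'
        intro: rev_image_eqI symG symH)
qed

lemma pair_graph_shell_graph: "pair_graph (shell_graph n)"
  unfolding shell_graph_def
  by (intro pair_graph_graph_join pair_graph_path_graph pair_graph_complete_graph)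

lemma card_pverts_shell_graph: "n \<ge> 1 \<Longrightarrow> card (pverts (shell_graph n)) = n"
  by (simp add: shell_graph_def graph_join_def path_graph_def complete_graph_def card_image
      card_insert_if image_iff lessThan_Suc)

end

theory Submission
  imports Defs
begin

text \<open>
  The apex is adjacent to every other vertex, so distances in the shell graph are at most 2, and two
  distinct non-adjacent vertices see each other iff some common neighbour lies outside the set.
  The apex itself is in the set, so non-adjacent vertices of \<open>A\<close> need a common neighbour
  on the path, which forces them to be \<open>i\<close> and \<open>i + 2\<close> with \<open>i + 1 \<notin> A\<close>.
\<close>

section \<open>Distances and visibility in an arbitrary finite simple graph\<close>

context pair_graph
begin

text \<open>The infimum defining \<open>gdist\<close> can be replaced by an actual walk because walk
  lengths are natural numbers.\<close>

lemma gdist_le_iff: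
  "gdist G u v \<le> ereal (real k) \<longleftrightarrow> (\<exists>p. awalk u p v \<and> length p \<le> k)"
proof
  assume "gdist G u v \<le> ereal (real k)"
  \<comment> \<open>A strict bound is needed to extract a walk from the infimum; integrality turns
    \<open>< Suc k\<close> back into \<open>\<le> k\<close>.\<close>
  also have "\<dots> < ereal (real (Suc k))"
    by simp
  finally obtain p where "awalk u p v" "real (length p) < real (Suc k)"
    by (auto simp: gdist_def \<mu>_def INF_less_iff awalk_cost_def sum_list_triv)
  then have "awalk u p v \<and> length p \<le> k"
    by simp
  then show "\<exists>p. awalk u p v \<and> length p \<le> k" ..
next
  assume "\<exists>p. awalk u p v \<and> length p \<le> k"
  then obtain p where p: "awalk u p v" "length p \<le> k"
    by blast
  have "gdist G u v \<le> ereal (awalk_cost (\<lambda>_. 1) p)"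
    unfolding gdist_def using p(1) by (rule min_cost_le_walk_cost)
  also have "\<dots> \<le> ereal (real k)"
    using p(2) by (simp add: awalk_cost_def sum_list_triv)
  finally show "gdist G u v \<le> ereal (real k)" .
qed

text \<open>The disjuncts are the walks with zero, one and two arcs. Only the empty walk has to
  state that \<open>u\<close> is a vertex.\<close>

lemma gdist_le_2_iff:
  "gdist G u v \<le> 2 \<longleftrightarrow>
    u = v \<and> u \<in> pverts G \<or> (u, v) \<in> parcs G \<or> (\<exists>w. (u, w) \<in> parcs G \<and> (w, v) \<in> parcs G)"
    (is "_ \<longleftrightarrow> ?R")
proof -
  have "gdist G u v \<le> 2 \<longleftrightarrow> (\<exists>p. awalk u p v \<and> length p \<le> 2)"
    using gdist_le_iff[of u v 2] by simp
  also have "\<dots> \<longleftrightarrow> ?R"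
  proof
    assume "\<exists>p. awalk u p v \<and> length p \<le> 2"
    then obtain p where p: "awalk u p v" "length p \<le> 2"
      by blast
    consider "p = []" | e where "p = [e]" | e f where "p = [e, f]"
      using p(2) by (cases p; cases "tl p") auto
    then show ?R
      using p(1) by cases (auto simp: awalk_simps)
  next
    assume ?R
    then consider "u = v" "u \<in> pverts G" | "(u, v) \<in> parcs G"
      | w where "(u, w) \<in> parcs G" "(w, v) \<in> parcs G"
      by blast
    then show "\<exists>p. awalk u p v \<and> length p \<le> 2"
    proof cases
      case 1
      then show ?thesis by (intro exI[of _ "[]"]) (auto simp: awalk_simps)
    next
      case 2
      then show ?thesis
        by (intro exI[of _ "[(u, v)]"]) (auto simp: awalk_simps dest: in_arcsD2)
    next
      case 3
      then show ?thesis
        by (intro exI[of _ "[(u, w), (w, v)]"]) (auto simp: awalk_simps dest: in_arcsD2)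
    qed
  qed
  finally show ?thesis .
qed

text \<open>A path is a walk, so its length is never below the infimum \<open>gdist\<close>;
  equality thus amounts to being at most the length of every walk. This removes \<open>ereal\<close>
  from the visibility arguments.\<close>

lemma shortest_path_iff:
  "shortest_path G u p v \<longleftrightarrow> apath u p v \<and> (\<forall>q. awalk u q v \<longrightarrow> length p \<le> length q)"
proof (cases "apath u p v")
  case True
  then have p: "awalk u p v"
    by (simp add: apath_def)
  have "ereal (real (length p)) = gdist G u v \<longleftrightarrow> ereal (real (length p)) \<le> gdist G u v"
    using gdist_le_iff[of u v "length p"] p by (auto intro: antisym)
  also have "\<dots> \<longleftrightarrow> (\<forall>q. awalk u q v \<longrightarrow> length p \<le> length q)"
    by (auto simp: gdist_def \<mu>_def le_INF_iff awalk_cost_def sum_list_triv)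
  finally show ?thesis
    using True by (simp add: shortest_path_def)
qed (simp add: shortest_path_def)

lemma visible_refl: "u \<in> pverts G \<Longrightarrow> visible G X u u"
  unfolding visible_def shortest_path_iff
  by (intro exI[of _ "[]"]) (auto simp: apath_Nil_iff)

text \<open>Without loops the ends differ, so no walk between them is empty and the single arc is
  shortest; it has no interior vertex that could meet \<open>X\<close>.\<close>

lemma visible_adjacent:
  assumes "(u, v) \<in> parcs G"
  shows "visible G X u v"
proof -
  have "u \<noteq> v"
    using assms no_loops' by blast
  then have "length [(u, v)] \<le> length q" if "awalk u q v" for q
    using that by (cases q) (auto simp: awalk_Nil_iff)
  with assms \<open>u \<noteq> v\<close> show ?thesis
    unfolding visible_def shortest_path_iff
    by (intro exI[of _ "[(u, v)]"]) (auto simp: apath_simps dest: in_arcsD1 in_arcsD2)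
qed

text \<open>The vertex \<open>x\<close> only serves to make the distance exactly 2 and may itself
  lie in \<open>X\<close>. The shortest paths are then those through a single common neighbour
  \<open>w\<close>.\<close>

lemma visible_common_neighbour_iff:
  assumes "u \<noteq> v" "(u, v) \<notin> parcs G" "(u, x) \<in> parcs G" "(x, v) \<in> parcs G"
  shows "visible G X u v \<longleftrightarrow> (\<exists>w. w \<notin> X \<and> (u, w) \<in> parcs G \<and> (w, v) \<in> parcs G)"
proof
  assume "visible G X u v"
  then obtain p where p: "apath u p v" "\<And>q. awalk u q v \<Longrightarrow> length p \<le> length q"
    "set (pawalk_verts u p) \<inter> X \<subseteq> {u, v}"
    unfolding visible_def shortest_path_iff by auto
  have "awalk u [(u, x), (x, v)] v"
    using assms by (auto simp: awalk_simps dest: in_arcsD2)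
  from p(2)[OF this] have len: "length p \<le> 2"
    by simp
  have "p \<noteq> []" "p \<noteq> [e]" for e
    using p(1) assms(1,2) by (auto simp: apath_simps)
  with len obtain e f where ef: "p = [e, f]"
    by (cases p; cases "tl p") auto
  obtain w where "e = (u, w)" "f = (w, v)"
    using p(1) ef by (cases e; cases f) (auto simp: apath_simps)
  \<comment> \<open>The vertices of a path are distinct, so \<open>w\<close> is neither end and the
    intersection condition forces it out of \<open>X\<close>.\<close>
  with ef p(1,3) show "\<exists>w. w \<notin> X \<and> (u, w) \<in> parcs G \<and> (w, v) \<in> parcs G"
    by (intro exI[of _ w]) (auto simp: apath_simps)
next
  assume "\<exists>w. w \<notin> X \<and> (u, w) \<in> parcs G \<and> (w, v) \<in> parcs G"
  then obtain w where w: "w \<notin> X" "(u, w) \<in> parcs G" "(w, v) \<in> parcs G"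
    by blast
  have "length [(u, w), (w, v)] \<le> length q" if "awalk u q v" for q
    using that assms(1,2) by (cases q; cases "tl q") (auto simp: awalk_simps)
  moreover have "apath u [(u, w), (w, v)] v"
    using w assms(1) by (auto simp: apath_simps dest: in_arcsD1 in_arcsD2 no_loops')
  ultimately show "visible G X u v"
    unfolding visible_def shortest_path_iff using w(1)
    by (intro exI[of _ "[(u, w), (w, v)]"]) auto
qed

end

section \<open>Distance at most 2 in the path\<close>

lemma gdist_path_graph_le_2_iff:
  assumes "u < k" "v < k"
  shows "gdist (path_graph k) u v \<le> 2 \<longleftrightarrow> u \<le> v + 2 \<and> v \<le> u + 2"
proof -
  interpret pair_graph "path_graph k"
    by (rule pair_graph_path_graph)
  \<comment> \<open>The middle vertex is the successor of the smaller end; it lies below the larger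
    end, hence below \<open>k\<close>.\<close>
  have "(\<exists>w. (u, w) \<in> parcs (path_graph k) \<and> (w, v) \<in> parcs (path_graph k))"
    if "v = u + 2 \<or> u = v + 2"
    using that assms by (intro exI[of _ "if u < v then Suc u else Suc v"]) (auto simp: path_graph_def)
  moreover have "u \<le> v + 2 \<and> v \<le> u + 2 \<longleftrightarrow>
    u = v \<or> v = Suc u \<or> u = Suc v \<or> v = u + 2 \<or> u = v + 2"
    by auto
  ultimately show ?thesis
    using assms unfolding gdist_le_2_iff by (auto simp: path_graph_def)
qed

section \<open>Visibility in the shell graph\<close>

text \<open>The last equation covers a general \<open>Inr j\<close>, as it arises when a vertex
  ranges over the whole sum type.\<close>

lemma parcs_shell_graph:
  "(Inl i, Inl j) \<in> parcs (shell_graph n) \<longleftrightarrow>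
    i < n - 1 \<and> j < n - 1 \<and> (j = Suc i \<or> i = Suc j)"
  "(Inl i, apex) \<in> parcs (shell_graph n) \<longleftrightarrow> i < n - 1"
  "(apex, Inl i) \<in> parcs (shell_graph n) \<longleftrightarrow> i < n - 1"
  "(Inl i, Inr j) \<in> parcs (shell_graph n) \<longleftrightarrow> i < n - 1 \<and> j = 0"
  by (auto simp: shell_graph_def graph_join_def path_graph_def complete_graph_def apex_def)

lemma visible_shell_graph_Inl_iff:
  assumes "u < n - 1" "v < n - 1" "apex \<in> X"
  shows "visible (shell_graph n) X (Inl u) (Inl v) \<longleftrightarrow>
    u \<le> v + 1 \<and> v \<le> u + 1 \<or>
    v = u + 2 \<and> Inl (u + 1) \<notin> X \<or> u = v + 2 \<and> Inl (v + 1) \<notin> X"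
proof -
  interpret pair_graph "shell_graph n"
    by (rule pair_graph_shell_graph)
  consider "u = v" | "v = Suc u \<or> u = Suc v" | "u + 2 \<le> v \<or> v + 2 \<le> u"
    by linarith
  then show ?thesis
  proof cases
    case 1
    have "Inl u \<in> pverts (shell_graph n)"
      using assms(1) parcs_shell_graph(2) in_arcsD1 by blast
    with 1 show ?thesis
      using visible_refl by auto
  next
    case 2
    with assms(1,2) have "(Inl u, Inl v) \<in> parcs (shell_graph n)"
      by (auto simp: parcs_shell_graph)
    with 2 show ?thesis
      using visible_adjacent by auto
  next
    case 3
    \<comment> \<open>The apex is the common neighbour that puts the two ends at distance 2.\<close>
    with assms(1,2) have "visible (shell_graph n) X (Inl u) (Inl v) \<longleftrightarrow>
      (\<exists>w. w \<notin> X \<and> (Inl u, w) \<in> parcs (shell_graph n) \<and> (w, Inl v) \<in> parcs (shell_graph n))"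
      by (intro visible_common_neighbour_iff[of _ _ apex]) (auto simp: parcs_shell_graph)
    \<comment> \<open>The only neighbour of the form \<open>Inr j\<close> is the apex, which lies in
      \<open>X\<close>.\<close>
    also have "\<dots> \<longleftrightarrow> (\<exists>i. Inl i \<notin> X \<and> (Inl u, Inl i) \<in> parcs (shell_graph n)
      \<and> (Inl i, Inl v) \<in> parcs (shell_graph n))"
      using assms(3) by (auto simp: split_sum_ex parcs_shell_graph(4) apex_def)
    also have "\<dots> \<longleftrightarrow> v = u + 2 \<and> Inl (u + 1) \<notin> X \<or> u = v + 2 \<and> Inl (v + 1) \<notin> X"
      using assms(1,2) 3 by (auto simp: parcs_shell_graph(1))
    finally show ?thesis
      using 3 by auto
  qed
qed

text \<open>The apex is adjacent to all of \<open>A\<close>, so only pairs inside \<open>A\<close>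
  impose a condition.\<close>

lemma mutual_visibility_set_shell_graph_iff:
  assumes "n \<ge> 2" "A \<subseteq> {..<n - 1}"
  shows "mutual_visibility_set (shell_graph n) ({apex} \<union> Inl ` A) \<longleftrightarrow>
    (\<forall>u\<in>A. \<forall>v\<in>A. u \<le> v \<longrightarrow> v \<le> u + 1 \<or> v = u + 2 \<and> u + 1 \<notin> A)"
    (is "mutual_visibility_set ?G ?X \<longleftrightarrow> _")
proof -
  interpret pair_graph ?G
    by (rule pair_graph_shell_graph)
  have X: "?X \<subseteq> pverts ?G"
    using assms
    by (auto simp: shell_graph_def graph_join_def path_graph_def complete_graph_def apex_def)
  have "visible ?G ?X apex apex"
    using X by (intro visible_refl) auto
  moreover have "visible ?G ?X apex (Inl u)" "visible ?G ?X (Inl u) apex" if "u \<in> A" for u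
    using that assms(2) by (auto intro!: visible_adjacent simp: parcs_shell_graph)
  ultimately have "mutual_visibility_set ?G ?X \<longleftrightarrow>
    (\<forall>u\<in>A. \<forall>v\<in>A. visible ?G ?X (Inl u) (Inl v))"
    unfolding mutual_visibility_set_def using X by auto
  also have "\<dots> \<longleftrightarrow> (\<forall>u\<in>A. \<forall>v\<in>A. u \<le> v + 1 \<and> v \<le> u + 1 \<or>
    v = u + 2 \<and> u + 1 \<notin> A \<or> u = v + 2 \<and> v + 1 \<notin> A)"
  proof (intro ball_cong refl)
    fix u v assume "u \<in> A" "v \<in> A"
    then show "visible ?G ?X (Inl u) (Inl v) \<longleftrightarrow> u \<le> v + 1 \<and> v \<le> u + 1 \<or>
      v = u + 2 \<and> u + 1 \<notin> A \<or> u = v + 2 \<and> v + 1 \<notin> A"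
      using assms(2) by (subst visible_shell_graph_Inl_iff) (auto simp: apex_def)
  qed
  \<comment> \<open>The condition is symmetric in \<open>u\<close> and \<open>v\<close>, so ordered
    pairs suffice.\<close>
  also have "\<dots> \<longleftrightarrow> (\<forall>u\<in>A. \<forall>v\<in>A. u \<le> v \<longrightarrow> v \<le> u + 1 \<or> v = u + 2 \<and> u + 1 \<notin> A)"
    (is "?L \<longleftrightarrow> ?R")
  proof
    assume ?L
    show ?R
    proof (intro ballI impI)
      fix u v assume "u \<in> A" "v \<in> A" "u \<le> v"
      with \<open>?L\<close> have "u \<le> v + 1 \<and> v \<le> u + 1 \<or>
        v = u + 2 \<and> u + 1 \<notin> A \<or> u = v + 2 \<and> v + 1 \<notin> A"
        by blast
      with \<open>u \<le> v\<close> show "v \<le> u + 1 \<or> v = u + 2 \<and> u + 1 \<notin> A"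
        by auto
    qed
  next
    assume ?R
    then show ?L
      by (metis nat_le_linear le_add1 order_trans)
  qed
  finally show ?thesis .
qed

section \<open>From gaps to cardinality\<close>

text \<open>All gaps being at most 2 confines \<open>A\<close> to three consecutive numbers; within
  such a window, the ban on a midpoint between elements at gap 2 says exactly that not all three
  occur.\<close>

lemma gap_condition_iff_card:
  fixes A :: "nat set"
  assumes "finite A"
  shows "(\<forall>u\<in>A. \<forall>v\<in>A. u \<le> v \<longrightarrow> v \<le> u + 1 \<or> v = u + 2 \<and> u + 1 \<notin> A) \<longleftrightarrow>
    card A \<le> 2 \<and> (\<forall>u\<in>A. \<forall>v\<in>A. u \<le> v + 2 \<and> v \<le> u + 2)"
    (is "?L \<longleftrightarrow> ?R")
proof
  assume ?L
  then have gap: "v \<le> u + 1 \<or> v = u + 2 \<and> u + 1 \<notin> A" if "u \<in> A" "v \<in> A" "u \<le> v" for u v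
    using that by blast
  have "card A \<le> 2"
  proof (cases "A = {}")
    case False
    define m where "m = Min A"
    have m: "m \<in> A" "\<And>v. v \<in> A \<Longrightarrow> m \<le> v"
      using assms False by (auto simp: m_def)
    have "A \<subseteq> {m, m + 1} \<or> A \<subseteq> {m, m + 2}"
    proof (cases "m + 1 \<in> A")
      case True
      \<comment> \<open>An element \<open>m + 2\<close> would form a gap of 2 from \<open>m\<close>
        with its midpoint \<open>m + 1\<close> in \<open>A\<close>.\<close>
      then have "A \<subseteq> {m, m + 1}"
        using gap[OF m(1)] m(2) by (force simp: le_Suc_eq)
      then show ?thesis ..
    next
      case False
      have "v = m \<or> v = m + 2" if "v \<in> A" for v
      proof -
        have "v \<noteq> m + 1"
          using that False by blast
        then show ?thesis
          using gap[OF m(1) that m(2)[OF that]] m(2)[OF that] by linarith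
      qed
      then show ?thesis
        by blast
    qed
    moreover have "card B \<le> 2" if "B \<subseteq> {a, b}" for B and a b :: nat
    proof -
      have "card B \<le> card {a, b}"
        using that by (intro card_mono) auto
      also have "\<dots> \<le> 2"
        by (simp add: card_insert_if)
      finally show ?thesis .
    qed
    ultimately show ?thesis
      by blast
  qed simp
  moreover have "u \<le> v + 2 \<and> v \<le> u + 2" if "u \<in> A" "v \<in> A" for u v
    using gap[of u v] gap[of v u] that by linarith
  ultimately show ?R
    by blast
next
  assume R: ?R
  show ?L
  proof (intro ballI impI)
    fix u v assume uv: "u \<in> A" "v \<in> A" "u \<le> v"
    have "u + 1 \<notin> A" if "v = u + 2"
    proof
      assume "u + 1 \<in> A"
      \<comment> \<open>Three consecutive elements would exceed the bound 2 on
        \<open>card A\<close>.\<close>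
      with uv that have "card {u, u + 1, u + 2} \<le> card A"
        using assms by (intro card_mono) auto
      with R show False
        by simp
    qed
    moreover have "v \<le> u + 2"
      using R uv by blast
    ultimately show "v \<le> u + 1 \<or> v = u + 2 \<and> u + 1 \<notin> A"
      by linarith
  qed
qed

theorem lemma12:
  fixes n :: nat and A :: "nat set"
  assumes "n \<ge> 3"
    and "A \<subseteq> pverts (path_graph (n - 1))"
  shows "mutual_visibility_set (shell_graph n) ({apex} \<union> Inl ` A) \<longleftrightarrow>
    card A \<le> 2 \<and> (\<forall>u\<in>A. \<forall>v\<in>A. gdist (path_graph (n - 1)) u v \<le> 2)"
proof -
  have A: "A \<subseteq> {..<n - 1}"
    using assms(2) by (simp add: path_graph_def)
  then have "(\<forall>u\<in>A. \<forall>v\<in>A. gdist (path_graph (n - 1)) u v \<le> 2) \<longleftrightarrow>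
    (\<forall>u\<in>A. \<forall>v\<in>A. u \<le> v + 2 \<and> v \<le> u + 2)"
    by (intro ball_cong refl gdist_path_graph_le_2_iff) auto
  moreover have "finite A"
    using A finite_subset by blast
  \<comment> \<open>Both sides now reduce to the same arithmetic condition on the gaps in
    \<open>A\<close>.\<close>
  ultimately show ?thesis
    using mutual_visibility_set_shell_graph_iff[OF _ A] gap_condition_iff_card assms(1) by simp
qed

end
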